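(* For every integer $n>2$, the number of prime numbers in the open interval $(4n,5n)$ is at least \[\log_{5n}\left[\frac{0.054886}{2^{\frac{n}{2}}n^{\frac{3}{2}}}\left(\frac{3125}{256}\right)^{\frac{n}{6}}(5n)^{-\frac{2.51012\sqrt{5n}}{\log(5n)}}\right].\]
   Context: $\log$ denotes the natural logarithm and $\log_{b} x=\log x/\log b$ is the logarithm to base $b$. *)

theory Defs
  imports Complex_Main "HOL-Computational_Algebra.Primes"
begin

end

(* Chebyshev's method: the combination log [m]! - log [m/2]! - log [m/3]! - log [m/5]! + log [m/30]!
   equals the sum of Lambda(d) w(m div d) over d <= m, where the weight w takes values in {0,1} and is 1
   on {1..5}.  With Stirling's formula this yields
     A m - O(log m) <= psi(m) <= (6/5) A m + O(log^2 m),  A = 0.9212...,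
   and hence psi(5n) - psi(4n) >= (A/5) n - O(log^2 n), where A/5 = 0.184... .  The proper prime powers
   in (4n,5n] have distinct prime bases of size at most s = sqrt(5n), so they contribute at most
   (s/2 + 1) log s.  The numerator of the claimed bound is only
   (5/6 log 5 - 11/6 log 2) n - 2.51012 s = 0.0705... n - 2.51012 s, up to negative terms; it is negative
   for s < 128, and beyond that the gap between 0.184 and 0.0705 absorbs all error terms. *)
theory Submission
  imports Defs "HOL-Number_Theory.Prime_Powers" "HOL-Analysis.Harmonic_Numbers"
begin

section \<open>Factorials: expansion by the von Mangoldt function and Stirling-type bounds\<close>

lemma sum_mangoldt_mult_div:
  fixes m N :: nat
  assumes "m \<le> N"
  shows "(\<Sum>d=1..N. mangoldt d * real (m div d)) = ln (fact m)"
  using assms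
proof (induction m)
  case (Suc m)
  \<comment> \<open>Passing from \<open>m\<close> to \<open>Suc m\<close> raises the quotient by
    \<open>d\<close> exactly when \<open>d\<close> divides \<open>Suc m\<close>; the increments add
    up to the divisor sum of \<open>mangoldt\<close>, which is \<open>ln (Suc m)\<close>.\<close>
  have "(\<Sum>d=1..N. mangoldt d * real (Suc m div d))
      = (\<Sum>d=1..N. mangoldt d * real (m div d) + (if d dvd Suc m then mangoldt d else 0))"
    by (intro sum.cong) (auto simp: div_Suc dvd_eq_mod_eq_0 algebra_simps)
  also have "\<dots> = ln (fact m) + (\<Sum>d=1..N. if d dvd Suc m then mangoldt d else 0)"
    using Suc by (simp add: sum.distrib)
  also have "(\<Sum>d=1..N. if d dvd Suc m then mangoldt d else 0) = (\<Sum>d | d dvd Suc m. (mangoldt d :: real))"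
  proof (intro sum.mono_neutral_cong_right)
    show "{d. d dvd Suc m} \<subseteq> {1..N}"
    proof
      fix d assume "d \<in> {d. d dvd Suc m}"
      thus "d \<in> {1..N}" using dvd_imp_le[of d "Suc m"] dvd_pos_nat[of "Suc m" d] Suc.prems by auto
    qed
  qed auto
  also have "\<dots> = ln (real (Suc m))"
    by (subst mangoldt_sum) auto
  finally show ?case
    by (simp add: ln_mult)
qed auto

lemma ln_fact_le:
  assumes "n \<ge> 1"
  shows "ln (fact n :: real) \<le> real n * ln n - n + 1 + ln n"
  using assms
proof (induction n rule: nat_induct_at_least)
  case (Suc n)
  have "ln (real n / real (Suc n)) \<le> real n / real (Suc n) - 1"
    using Suc.hyps by (intro ln_le_minus_one) auto
  hence "ln (real n) - ln (real (Suc n)) \<le> - 1 / real (Suc n)"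
    using Suc.hyps by (subst (asm) ln_div) (auto simp: field_simps)
  hence "(real n + 1) * (ln (real n) - ln (real (Suc n))) \<le> -1"
    by (simp add: field_simps)
  moreover have "ln (fact (Suc n)) = ln (real n + 1) + ln (fact n)"
    by (simp add: ln_mult add_ac)
  ultimately show ?case using Suc.IH
    by (simp add: algebra_simps)
qed auto

text \<open>The logarithm is taken at \<open>n + 1\<close> because \<open>n\<close> will be the
  integer part of a real \<open>x\<close>, and then \<open>x \<le> n + 1\<close>.\<close>

lemma ln_fact_ge: "ln (fact n :: real) \<ge> real n * ln (real n + 1) - n"
proof (induction n)
  case (Suc n)
  have "ln (real (n+2) / real (n+1)) \<le> real (n+2) / real (n+1) - 1"
    by (intro ln_le_minus_one) auto
  hence "ln (real (n+2)) - ln (real (n+1)) \<le> 1 / real (n+1)"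
    by (subst (asm) ln_div) (auto simp: field_simps)
  hence "(real n + 1) * (ln (real n + 2) - ln (real n + 1)) \<le> 1"
    by (simp add: field_simps)
  moreover have "ln (fact (Suc n)) = ln (real n + 1) + ln (fact n)"
    by (simp add: ln_mult add_ac)
  ultimately show ?case using Suc.IH
    by (simp add: algebra_simps)
qed auto

lemma mult_ln_minus_self_mono:
  fixes x y :: real
  assumes "1 \<le> x" "x \<le> y"
  shows "x * ln x - x \<le> y * ln y - y"
proof (rule DERIV_nonneg_imp_nondecreasing[OF assms(2)])
  fix z assume "x \<le> z" "z \<le> y"
  thus "\<exists>d. ((\<lambda>z. z * ln z - z) has_real_derivative d) (at z) \<and> 0 \<le> d"
    using assms by (intro exI[of _ "ln z"]) (auto intro!: derivative_eq_intros)
qed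

text \<open>The main term is taken at the exact quotient \<open>x\<close>, not at its integer part,
  so that the main terms of Chebyshev's combination cancel exactly; rounding is paid for by the
  error \<open>ln m + 1\<close>.\<close>

lemma ln_fact_div_bounds:
  fixes m k :: nat
  assumes "m \<ge> 1" "k \<ge> 1"
  defines "x \<equiv> real m / real k"
  shows "\<bar>ln (fact (m div k)) - (x * ln x - x)\<bar> \<le> ln m + 1"
proof -
  define f where "f = m div k"
  have x: "x > 0" "x \<le> m" "real f \<le> x" "x \<le> real f + 1"
  proof -
    show "x > 0" using assms by (auto simp: x_def)
    show "x \<le> m" using assms by (auto simp: x_def field_simps)
    have f: "f = nat \<lfloor>x\<rfloor>" by (simp add: f_def x_def floor_divide_of_nat_eq)
    show "real f \<le> x" "x \<le> real f + 1" using \<open>x > 0\<close> unfolding f by linarith+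
  qed
  have lnm: "ln m \<ge> 0" "ln x \<le> ln m" using assms x by auto
  show ?thesis
  proof (cases "f = 0")
    case True
    \<comment> \<open>Monotonicity of \<open>x * ln x - x\<close> is available only from 1 on. Here
      the factorial is 1 and \<open>x * ln x - x\<close> lies between -1 and 0.\<close>
    hence "x \<le> 1" using x by simp
    hence "x * ln x \<le> 0" using x by (simp add: mult_nonneg_nonpos)
    moreover have "x * (ln (1/x)) \<le> x * (1/x - 1)"
      using x by (intro mult_left_mono ln_le_minus_one) auto
    hence "x * ln x \<ge> x - 1" using x by (simp add: ln_div algebra_simps)
    moreover have "ln (fact (m div k)) = (0 :: real)" using True by (simp add: f_def)
    ultimately show ?thesis using lnm(1) x \<open>x \<le> 1\<close> by linarith
  next
    case False
    hence f1: "f \<ge> 1" by simp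
    hence "x \<ge> 1" using x by linarith
    have "ln (fact f) \<le> real f * ln f - f + 1 + ln f" by (rule ln_fact_le) fact
    also have "real f * ln f - f \<le> x * ln x - x"
      using f1 x by (intro mult_ln_minus_self_mono) auto
    also have "ln f \<le> ln m" using f1 x by (intro ln_mono) auto
    finally have upper: "ln (fact f) \<le> x * ln x - x + 1 + ln m" by simp
    \<comment> \<open>Giving up one \<open>ln x\<close> lowers the coefficient to
      \<open>x - 1\<close>, which is at most \<open>f\<close>; then \<open>x \<le> f + 1\<close>
      leads to \<open>ln_fact_ge\<close>.\<close>
    have "x * ln x - x - ln m \<le> x * ln x - x - ln x" using lnm by simp
    also have "\<dots> = (x - 1) * ln x - x" by (simp add: algebra_simps)
    also have "\<dots> \<le> real f * ln x - f" 
      using x \<open>x \<ge> 1\<close> by (intro diff_mono mult_right_mono) auto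
    also have "\<dots> \<le> real f * ln (real f + 1) - f"
      using x by (intro diff_mono mult_left_mono ln_mono) auto
    also have "\<dots> \<le> ln (fact f)" by (rule ln_fact_ge)
    finally show ?thesis using upper unfolding f_def by linarith
  qed
qed

section \<open>Chebyshev's weight and the bounds for psi\<close>

definition chebyshev_const :: real where
  "chebyshev_const = ln 2 / 2 + ln 3 / 3 + ln 5 / 5 - ln 30 / 30"

lemma chebyshev_const_eq: "chebyshev_const = 7 / 15 * ln 2 + 3 / 10 * ln 3 + 1 / 6 * ln 5"
  using ln_mult[of 2 "15::real"] ln_mult[of 3 "5::real"] by (simp add: chebyshev_const_def add_divide_distrib)

definition chebyshev_psi :: "nat \<Rightarrow> real" where
  "chebyshev_psi m = (\<Sum>d=1..m. mangoldt d)"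

text \<open>The coefficient of \<open>mangoldt d\<close> in Chebyshev's combination, at
  \<open>q = m div d\<close>. Integers avoid truncated subtraction.\<close>

definition chebyshev_weight :: "nat \<Rightarrow> int" where
  "chebyshev_weight q = int q - int (q div 2) - int (q div 3) - int (q div 5) + int (q div 30)"

text \<open>The weight has period 30, since 30 - 15 - 10 - 6 + 1 = 0; this leaves a check of the 30
  residues, for which the last quotient vanishes.\<close>

lemma chebyshev_weight_bounds: "chebyshev_weight q \<in> {0..1}"
proof -
  define k r where "k = q div 30" and "r = q mod 30"
  have q: "q = r + 30 * k" by (simp add: k_def r_def)
  have k: "q div 30 = k" by (simp add: k_def)
  have "q div 2 = r div 2 + 15 * k" "q div 3 = r div 3 + 10 * k" "q div 5 = r div 5 + 6 * k"
    using div_mult_self2[of 2 r "15 * k"] div_mult_self2[of 3 r "10 * k"] div_mult_self2[of 5 r "6 * k"]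
    unfolding q by (simp_all add: ac_simps)
  hence "chebyshev_weight q = int r - int (r div 2) - int (r div 3) - int (r div 5)"
    unfolding chebyshev_weight_def k by (simp add: q)
  moreover have "r \<in> set [0..<30]" by (simp add: r_def)
  hence "int r - int (r div 2) - int (r div 3) - int (r div 5) \<in> {0..1}"
    by (simp add: upt_rec) (elim disjE; simp)
  ultimately show ?thesis by simp
qed

lemma chebyshev_weight_eq_1: "1 \<le> q \<Longrightarrow> q < 6 \<Longrightarrow> chebyshev_weight q = 1"
proof -
  assume "1 \<le> q" "q < 6"
  hence "q \<in> set [1..<6]" by simp
  thus ?thesis by (auto simp: upt_rec chebyshev_weight_def)
qed

text \<open>Five log-factorials, each with error at most \<open>ln m + 1\<close>. As 1 - 1/2 - 1/3 -
  1/5 + 1/30 = 0, the \<open>m * ln m\<close> terms cancel and only a multiple of \<open>m\<close>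
  remains.\<close>

lemma sum_mangoldt_chebyshev_weight:
  assumes "m \<ge> 1"
  shows "\<bar>(\<Sum>d=1..m. mangoldt d * chebyshev_weight (m div d)) - chebyshev_const * m\<bar> \<le> 5 * ln m + 5"
proof -
  define T where "T = (\<lambda>k. ln (fact (m div k) :: real))"
  define x where "x = (\<lambda>k. real m / k)"
  \<comment> \<open>All five factorials are expanded over the same range of \<open>d\<close>; hence
    the free upper limit in \<open>sum_mangoldt_mult_div\<close>.\<close>
  have T: "(\<Sum>d=1..m. mangoldt d * real (m div d div k)) = T k" for k
  proof -
    have "m div d div k = m div k div d" for d by (simp add: div_mult2_eq [symmetric] mult.commute)
    thus ?thesis using sum_mangoldt_mult_div[of "m div k" m] by (simp add: T_def)
  qed
  have "(\<Sum>d=1..m. mangoldt d * chebyshev_weight (m div d)) = T 1 - T 2 - T 3 - T 5 + T 30"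
    unfolding T[symmetric] sum.distrib[symmetric] sum_subtractf[symmetric]
    by (intro sum.cong) (auto simp: chebyshev_weight_def algebra_simps)
  moreover have "\<bar>T k - (x k * ln (x k) - x k)\<bar> \<le> ln m + 1" if "k \<ge> 1" for k
    using ln_fact_div_bounds[OF assms that] by (simp add: T_def x_def)
  from this[of 1] this[of 2] this[of 3] this[of 5] this[of 30]
  have "\<bar>T 1 - (x 1 * ln (x 1) - x 1)\<bar> \<le> ln m + 1" "\<bar>T 2 - (x 2 * ln (x 2) - x 2)\<bar> \<le> ln m + 1"
    "\<bar>T 3 - (x 3 * ln (x 3) - x 3)\<bar> \<le> ln m + 1" "\<bar>T 5 - (x 5 * ln (x 5) - x 5)\<bar> \<le> ln m + 1"
    "\<bar>T 30 - (x 30 * ln (x 30) - x 30)\<bar> \<le> ln m + 1" by simp_all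
  moreover have "(x 1 * ln (x 1) - x 1) - (x 2 * ln (x 2) - x 2) - (x 3 * ln (x 3) - x 3)
      - (x 5 * ln (x 5) - x 5) + (x 30 * ln (x 30) - x 30) = chebyshev_const * m"
  proof -
    have "x k * ln (x k) - x k = m * ((ln m - ln k - 1) / k)" if "k \<ge> 1" for k
      using that assms by (simp add: x_def ln_div diff_divide_distrib right_diff_distrib)
    thus ?thesis
      by (simp add: chebyshev_const_def) (simp add: algebra_simps add_divide_distrib diff_divide_distrib)
  qed
  ultimately show ?thesis by linarith
qed

lemma chebyshev_psi_ge:
  assumes "m \<ge> 1"
  shows "chebyshev_psi m \<ge> chebyshev_const * m - 5 * ln m - 5"
proof -
  have "(\<Sum>d=1..m. mangoldt d * chebyshev_weight (m div d)) \<le> (\<Sum>d=1..m. mangoldt d * 1)"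
    using chebyshev_weight_bounds by (intro sum_mono mult_left_mono mangoldt_nonneg) auto
  thus ?thesis
    using sum_mangoldt_chebyshev_weight[OF assms] by (simp add: chebyshev_psi_def)
qed

text \<open>For \<open>d\<close> above \<open>m div 6\<close> the quotient \<open>m div d\<close> is
  one of 1 to 5, where the weight is 1; the remaining terms of the weighted sum are
  nonnegative.\<close>

lemma chebyshev_psi_diff_le:
  assumes "m \<ge> 1"
  shows "chebyshev_psi m - chebyshev_psi (m div 6) \<le> chebyshev_const * m + 5 * ln m + 5"
proof -
  have "{1..m} = {1..m div 6} \<union> {m div 6<..m}" by auto
  hence "chebyshev_psi m = chebyshev_psi (m div 6) + (\<Sum>d\<in>{m div 6<..m}. mangoldt d)"
    unfolding chebyshev_psi_def by (subst sum.union_disjoint [symmetric]) auto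
  hence "chebyshev_psi m - chebyshev_psi (m div 6)
      = (\<Sum>d\<in>{m div 6<..m}. mangoldt d * chebyshev_weight (m div d))"
  proof -
    have "chebyshev_weight (m div d) = 1" if "d \<in> {m div 6<..m}" for d
    proof (rule chebyshev_weight_eq_1)
      show "1 \<le> m div d" using that by (auto simp: Suc_le_eq div_greater_zero_iff)
      show "m div d < 6" using that by (auto simp: div_less_iff_less_mult mult.commute)
    qed
    thus ?thesis using \<open>chebyshev_psi m = _\<close> by simp
  qed
  also have "\<dots> \<le> (\<Sum>d=1..m. mangoldt d * chebyshev_weight (m div d))"
    using chebyshev_weight_bounds
    by (intro sum_mono2) (auto intro!: mult_nonneg_nonneg mangoldt_nonneg)
  finally show ?thesis
    using sum_mangoldt_chebyshev_weight[OF assms] by linarith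
qed

lemma ln_numeral_bounds:
  "ln 2 \<in> {0.693..0.6932::real}" "ln 3 \<in> {1.098..1.0987::real}" "ln 5 \<in> {1.609..1.6095::real}"
proof -
  have 2: "ln 2 \<in> {0.6931..0.69316::real}"
    using ln_approx_bounds[of 2 5] by (simp add: eval_nat_numeral)
  \<comment> \<open>Arguments close to 1 need fewer terms of the approximation, so
    \<open>ln 3\<close> and \<open>ln 5\<close> are assembled from \<open>ln (3/2)\<close>,
    \<open>ln (5/4)\<close> and \<open>ln 2\<close>.\<close>
  have 3: "ln (3/2) \<in> {0.4054..0.4055::real}"
    using ln_approx_bounds[of "3/2" 3] by (simp add: eval_nat_numeral)
  have 5: "ln (5/4) \<in> {0.2231..0.22315::real}"
    using ln_approx_bounds[of "5/4" 3] by (simp add: eval_nat_numeral)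
  have "ln (3::real) = ln (3/2) + ln 2" "ln (5::real) = ln (5/4) + 2 * ln 2"
    using ln_realpow[of 2 2] by (simp_all add: ln_div)
  with 2 3 5 show "ln 2 \<in> {0.693..0.6932::real}" "ln 3 \<in> {1.098..1.0987::real}" "ln 5 \<in> {1.609..1.6095::real}"
    by auto
qed

text \<open>Iterating \<open>chebyshev_psi_diff_le\<close> along \<open>m\<close>,
  \<open>m div 6\<close>, ... gives a geometric series with factor 6/5; logarithmically many errors
  of size O(log m) give the squared logarithm.\<close>

lemma chebyshev_psi_le:
  assumes "m \<ge> 1"
  shows "chebyshev_psi m \<le> 6 / 5 * chebyshev_const * m + 7 / 5 * (ln m)\<^sup>2 + 27 / 5 * ln m + 5"
  using assms
proof (induction m rule: less_induct)
  case (less m)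
  have c: "chebyshev_const \<ge> 0"
    using ln_numeral_bounds by (simp add: chebyshev_const_eq)
  show ?case
  proof (cases "m < 6")
    case True
    hence "chebyshev_psi (m div 6) = 0" by (simp add: chebyshev_psi_def)
    moreover have "chebyshev_const * m \<le> 6 / 5 * chebyshev_const * m"
      using c by (intro mult_right_mono) auto
    moreover have "ln m \<ge> 0" using less.prems by simp
    ultimately show ?thesis
      using chebyshev_psi_diff_le[OF less.prems] zero_le_power2[of "ln (real m)"] by linarith
  next
    case False
    define l where "l = ln (real m)"
    have l6: "ln (6::real) \<in> {1.791..1.7919}"
      using ln_numeral_bounds ln_mult[of 2 "3::real"] by simp
    have "real (m div 6) \<le> real m / 6" using of_nat_div_le_of_nat[of m 6, where ?'a = real] by simp
    hence "ln (real (m div 6)) \<le> ln (real m / 6)" 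
      using False by (intro ln_mono) auto
    hence ln_le: "ln (real (m div 6)) \<le> l - ln 6" using False by (simp add: ln_div l_def)
    have nonneg: "ln (real (m div 6)) \<ge> 0" using False by simp
    have "chebyshev_psi (m div 6)
        \<le> 6 / 5 * chebyshev_const * (m div 6) + 7 / 5 * (ln (m div 6))\<^sup>2 + 27 / 5 * ln (m div 6) + 5"
      using False by (intro less.IH) auto
    also have "\<dots> \<le> 6 / 5 * chebyshev_const * (m / 6) + 7 / 5 * (l - ln 6)\<^sup>2 + 27 / 5 * (l - ln 6) + 5"
      using c ln_le nonneg \<open>real (m div 6) \<le> real m / 6\<close>
      by (intro add_mono mult_left_mono power_mono) auto
    finally have "chebyshev_psi m \<le> 6 / 5 * chebyshev_const * m
        + (7 / 5 * (l - ln 6)\<^sup>2 + 27 / 5 * l - 27 / 5 * ln 6 + 5 * l + 10)"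
      using chebyshev_psi_diff_le[OF less.prems] unfolding l_def by (simp add: diff_divide_distrib)
    \<comment> \<open>The coefficients close the induction: \<open>14 / 5 * ln 6\<close> exceeds 5
      and absorbs the new \<open>5 * l\<close>, and \<open>27 / 5 * ln 6\<close> exceeds
      \<open>7 / 5 * (ln 6)\<^sup>2 + 5\<close>.\<close>
    moreover have "7 / 5 * (l - ln 6)\<^sup>2 = 7 / 5 * l\<^sup>2 - 14 / 5 * (l * ln 6) + 7 / 5 * (ln 6)\<^sup>2"
      by (simp add: power2_diff)
    moreover have "(ln 6)\<^sup>2 \<le> (3211 / 1000 :: real)"
      using power_mono[of "ln 6" "1.7919 :: real" 2] l6 by (simp add: power2_eq_square)
    moreover have "l \<ge> 0" using less.prems by (simp add: l_def)
    moreover from this have "l * ln 6 \<ge> l * (1791 / 1000)"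
      using l6 by (intro mult_left_mono) auto
    moreover have "ln 6 \<ge> (1791 / 1000 :: real)" using l6 by simp
    ultimately show ?thesis unfolding l_def[symmetric] by linarith
  qed
qed

section \<open>Proper prime powers, and the passage from psi to a count of primes\<close>

lemma card_primes_le: "card {p::nat. prime p \<and> p \<le> r} \<le> r div 2 + 1"
proof -
  have "{p. prime p \<and> p \<le> r} \<subseteq> insert 2 ((\<lambda>k. 2 * k + 1) ` {1..r div 2})"
  proof
    fix p assume p: "p \<in> {p. prime p \<and> p \<le> r}"
    show "p \<in> insert 2 ((\<lambda>k. 2 * k + 1) ` {1..r div 2})"
    proof (cases "p = 2")
      case False
      hence "odd p" "p > 2" using p prime_odd_nat[of p] prime_ge_2_nat[of p] by auto
      then obtain k where "p = 2 * k + 1" by (auto elim: oddE)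
      thus ?thesis using p \<open>p > 2\<close> by auto
    qed auto
  qed
  hence "card {p. prime p \<and> p \<le> r} \<le> card (insert 2 ((\<lambda>k. 2 * k + 1) ` {1..r div 2}))"
    by (intro card_mono) auto
  also have "\<dots> \<le> Suc (card ((\<lambda>k. 2 * k + 1) ` {1..r div 2}))"
    by (rule card_insert_le_m1) auto
  also have "\<dots> \<le> Suc (card {1..r div 2})"
    by (intro Suc_le_mono[THEN iffD2] card_image_le) auto
  finally show ?thesis by simp
qed


lemma aprimedivisor_sqrt_bound:
  assumes "primepow d" "\<not> prime d"
  shows "aprimedivisor d ^ 2 \<le> (d :: nat)"
proof -
  obtain p k where pk: "prime p" "k > 0" "d = p ^ k"
    using assms(1) by (auto simp: primepow_def)
  moreover have "k \<noteq> 1" using assms(2) pk by auto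
  ultimately have "p ^ 2 \<le> p ^ k"
    by (intro power_increasing) (auto simp: prime_ge_Suc_0_nat)
  thus ?thesis using pk by (simp add: aprimedivisor_prime_power)
qed

text \<open>Distinct powers of one prime differ by a factor of at least 2, too much for two of them
  to lie above \<open>M\<close> and at most \<open>2 * M\<close>.\<close>

lemma inj_on_aprimedivisor:
  assumes "N \<le> 2 * M"
  shows "inj_on aprimedivisor {d::nat. M < d \<and> d \<le> N \<and> primepow d}"
proof -
  have less: False
    if "prime p" "M < p ^ j" "p ^ k \<le> N" "j < k" for p j k :: nat
  proof -
    have "2 * p ^ j \<le> p ^ Suc j" using prime_ge_2_nat[OF that(1)] by simp
    also have "\<dots> \<le> p ^ k" using that by (intro power_increasing) (auto simp: prime_ge_Suc_0_nat)
    finally show False using that assms by linarith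
  qed
  show ?thesis
  proof (rule inj_onI)
    fix d e assume de: "d \<in> {d. M < d \<and> d \<le> N \<and> primepow d}" "e \<in> {d. M < d \<and> d \<le> N \<and> primepow d}"
      "aprimedivisor d = aprimedivisor e"
    obtain p k where pk: "prime p" "k > 0" "d = p ^ k" using de(1) by (auto simp: primepow_def)
    obtain q l where ql: "prime q" "l > 0" "e = q ^ l" using de(2) by (auto simp: primepow_def)
    have "p = q" using de(3) pk ql by (simp add: aprimedivisor_prime_power)
    thus "d = e" using less[of p k l] less[of p l k] pk ql de by (cases k l rule: linorder_cases) auto
  qed
qed

text \<open>Mapping each proper prime power to its base is injective into the primes up to
  \<open>sqrt N\<close>, and each term is the logarithm of that base.\<close>

lemma sum_mangoldt_proper_primepow_le:
  assumes "N \<le> 2 * M" "N \<ge> 1"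
  shows "(\<Sum>d\<in>{M<..N}. if prime d then 0 else mangoldt d) \<le> (sqrt N / 2 + 1) * ln (sqrt N)"
proof -
  define D where "D = {d. M < d \<and> d \<le> N \<and> primepow d \<and> \<not> prime d}"
  define r where "r = nat \<lfloor>sqrt N\<rfloor>"
  have r: "real r \<le> sqrt N" by (simp add: r_def)
  have bound: "prime (aprimedivisor d) \<and> real (aprimedivisor d) \<le> sqrt N" if "d \<in> D" for d
  proof
    show "prime (aprimedivisor d)"
      using that by (intro prime_aprimedivisor') (auto simp: D_def primepow_gt_0_nat dest: primepow_not_unit)
    have "aprimedivisor d ^ 2 \<le> N"
      using that aprimedivisor_sqrt_bound[of d] by (auto simp: D_def)
    hence "real (aprimedivisor d) ^ 2 \<le> real N"
      by (metis of_nat_le_iff of_nat_power)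
    thus "real (aprimedivisor d) \<le> sqrt N" by (rule real_le_rsqrt)
  qed
  have "finite D" by (rule finite_subset[of _ "{..N}"]) (auto simp: D_def)
  have "card D \<le> card {p. prime p \<and> p \<le> r}"
  proof (rule card_inj_on_le)
    show "inj_on aprimedivisor D"
      by (rule inj_on_subset[OF inj_on_aprimedivisor[OF assms(1)]]) (auto simp: D_def)
    show "aprimedivisor ` D \<subseteq> {p. prime p \<and> p \<le> r}"
      using bound by (auto simp: r_def le_nat_floor)
  qed auto
  also have "\<dots> \<le> r div 2 + 1" by (rule card_primes_le)
  finally have card: "real (card D) \<le> sqrt N / 2 + 1"
    using r by linarith
  have "(\<Sum>d\<in>{M<..N}. if prime d then 0 else mangoldt d) = (\<Sum>d\<in>D. ln (real (aprimedivisor d)))"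
    by (intro sum.mono_neutral_cong_right) (auto simp: D_def mangoldt_def)
  also have "\<dots> \<le> (\<Sum>d\<in>D. ln (sqrt N))"
    using bound by (intro sum_mono ln_mono) (auto dest: prime_gt_0_nat)
  also have "\<dots> \<le> (sqrt N / 2 + 1) * ln (sqrt N)"
    using card assms by (simp add: mult_right_mono)
  finally show ?thesis .
qed

lemma chebyshev_psi_diff_le_card_primes:
  assumes "M \<le> N" "N \<le> 2 * M" "N \<ge> 1"
  shows "chebyshev_psi N - chebyshev_psi M
    \<le> real (card {p. prime p \<and> M < p \<and> p \<le> N}) * ln N + (sqrt N / 2 + 1) * ln (sqrt N)"
proof -
  have "{1..N} = {1..M} \<union> {M<..N}" using assms by auto
  hence "chebyshev_psi N - chebyshev_psi M = (\<Sum>d\<in>{M<..N}. mangoldt d)"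
    unfolding chebyshev_psi_def by (subst (1) \<open>{1..N} = _\<close>, subst sum.union_disjoint) auto
  also have "\<dots> = (\<Sum>d\<in>{M<..N}. if prime d then ln d else 0)
      + (\<Sum>d\<in>{M<..N}. if prime d then 0 else mangoldt d)"
    unfolding sum.distrib[symmetric] by (intro sum.cong) auto
  also have "(\<Sum>d\<in>{M<..N}. if prime d then ln d else 0)
      = (\<Sum>d | prime d \<and> M < d \<and> d \<le> N. ln (real d))"
    by (intro sum.mono_neutral_cong_right) auto
  also have "\<dots> \<le> (\<Sum>d | prime d \<and> M < d \<and> d \<le> N. ln N)"
    by (intro sum_mono ln_mono) (auto dest: prime_gt_0_nat)
  also note sum_mangoldt_proper_primepow_le[OF assms(2,3)]
  finally show ?thesis by simp
qed

section \<open>Numerical comparison with the claimed bound\<close>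

lemma interval_primes_lower_bound:
  fixes s C :: real
  assumes s: "s \<ge> 128" "s\<^sup>2 = 5 * real n"
    and C: "chebyshev_psi (5 * n) - chebyshev_psi (4 * n) \<le> C + (s / 2 + 1) * ln s"
  shows "n * (5 / 6 * ln 5 - 11 / 6 * ln 2) - 2.51012 * s \<le> C"
proof -
  \<comment> \<open>A linear majorant of \<open>ln s\<close>, turning all error terms into
    polynomials in \<open>s\<close>: the tangent at 128 is \<open>7 * ln 2 - 1 + s / 128\<close>,
    and \<open>7 * ln 2 - 1\<close> is below 4.\<close>
  define v where "v = 4 + s / 128"
  have n: "n \<ge> 1" using s by (cases n) auto
  have "ln (s / 128) \<le> s / 128 - 1" using s by (intro ln_le_minus_one) auto
  hence ln_s: "ln s \<le> v"
    using s ln_numeral_bounds(1) ln_realpow[of 2 7] by (simp add: ln_div v_def)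
  have "ln (s\<^sup>2) = 2 * ln s" using s(1) ln_realpow[of s 2] by simp
  hence L: "ln (5 * real n) = 2 * ln s" unfolding s(2) .
  have "ln (4 * real n) \<le> ln (5 * real n)" "ln (4 * real n) \<ge> 0" using n by auto
  hence L4: "ln (4 * real n) \<le> 2 * v" "ln (4 * real n) \<ge> 0" using L ln_s by linarith+
  have "(ln (4 * real n))\<^sup>2 \<le> (2 * v)\<^sup>2" using L4 by (intro power_mono) auto
  hence "chebyshev_psi (4 * n) \<le> 24 / 5 * (chebyshev_const * n) + 1.4 * (2 * v)\<^sup>2 + 5.4 * (2 * v) + 5"
    using chebyshev_psi_le[of "4 * n"] n L4 by simp
  moreover have "chebyshev_psi (5 * n) \<ge> 5 * (chebyshev_const * n) - 5 * (2 * v) - 5"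
    using chebyshev_psi_ge[of "5 * n"] n L ln_s by simp
  moreover have "(s / 2 + 1) * ln s \<le> (s / 2 + 1) * v"
    using s ln_s by (intro mult_left_mono) auto
  \<comment> \<open>The main terms leave 5 - 24/5 = 1/5 of the constant; the errors combine as 1.4 *
    4 = 5.6, 2 * (5 + 5.4) = 20.8 and 5 + 5 = 10.\<close>
  ultimately have "C \<ge> chebyshev_const / 5 * n - 5.6 * v\<^sup>2 - 20.8 * v - 10 - (s / 2 + 1) * v"
    using C by (simp add: power_mult_distrib)
  moreover have "0.113 * n \<le> (chebyshev_const / 5 - (5 / 6 * ln 5 - 11 / 6 * ln 2)) * n"
    using ln_numeral_bounds
    by (intro mult_right_mono) (auto simp: chebyshev_const_eq add_divide_distrib)
  \<comment> \<open>The left side starts with \<open>0.113 * n\<close>, as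
    \<open>5 * n = s\<^sup>2\<close>. On the right the quadratic coefficient is only about 0.0042;
    the surplus, made linear by \<open>s\<^sup>2 \<ge> 128 * s\<close>, outweighs the constant
    186.8.\<close>
  moreover have "113 / 5000 * s\<^sup>2 + 2.51012 * s \<ge> 5.6 * v\<^sup>2 + 20.8 * v + 10 + (s / 2 + 1) * v"
  proof -
    have "s\<^sup>2 \<ge> 128 * s" using s(1) by (simp add: power2_eq_square)
    moreover have "v\<^sup>2 = 16 + s / 16 + s\<^sup>2 / 16384" "(s / 2 + 1) * v = 4 + 2 * s + s / 128 + s\<^sup>2 / 256"
      by (simp_all add: v_def power2_eq_square algebra_simps add_divide_distrib)
    ultimately show ?thesis using s(1) by (simp add: v_def add_divide_distrib)
  qed
  ultimately show ?thesis
    using s(2) by (simp add: algebra_simps)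
qed

theorem theorem4p0p1:
  fixes n :: nat
  assumes "n > 2"
  shows "real (card {p::nat. prime p \<and> 4 * n < p \<and> p < 5 * n})
    \<ge> log (5 * real n)
        (0.054886 / (2 powr (real n / 2) * real n powr (3 / 2))
          * (3125 / 256) powr (real n / 6)
          * (5 * real n) powr (- (2.51012 * sqrt (5 * real n) / ln (5 * real n))))"
proof -
  define s where "s = sqrt (5 * real n)"
  \<comment> \<open>Clearing the base of the logarithm reduces the claim to
    \<open>ln R \<le> C\<close>.\<close>
  define C where "C = real (card {p::nat. prime p \<and> 4 * n < p \<and> p < 5 * n}) * ln (5 * real n)"
  define R where "R = 0.054886 / (2 powr (real n / 2) * real n powr (3 / 2))
          * (3125 / 256) powr (real n / 6)
          * (5 * real n) powr (- (2.51012 * sqrt (5 * real n) / ln (5 * real n)))"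
  have s: "s > 0" "s\<^sup>2 = 5 * real n" using assms by (auto simp: s_def)
  have L: "ln (5 * real n) > 0" using assms by simp
  \<comment> \<open>The psi difference includes the right endpoint, the open interval does not;
    being composite, \<open>5 * n\<close> makes no difference to the count.\<close>
  have "\<not> prime (5 * n)"
    using assms by (auto simp: prime_nat_iff intro!: exI[of _ 5])
  hence "{p. prime p \<and> 4 * n < p \<and> p \<le> 5 * n} = {p. prime p \<and> 4 * n < p \<and> p < 5 * n}"
    by (auto simp: le_less)
  moreover have "ln (sqrt (real (5 * n))) = ln s" by (simp add: s_def)
  ultimately have psi: "chebyshev_psi (5 * n) - chebyshev_psi (4 * n) \<le> C + (s / 2 + 1) * ln s"
    using chebyshev_psi_diff_le_card_primes[of "4 * n" "5 * n"] assms by (simp add: C_def s_def)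
  have "ln (3125 / 256 :: real) = 5 * ln 5 - 8 * ln 2"
    using ln_realpow[of 5 5] ln_realpow[of 2 8] by (simp add: ln_div)
  \<comment> \<open>The denominator \<open>ln (5 * real n)\<close> of the exponent cancels against
    the logarithm of the base.\<close>
  moreover have "ln ((5 * real n) powr (- (2.51012 * sqrt (5 * real n) / ln (5 * real n)))) = - 2.51012 * s"
    using assms L by (simp add: ln_powr s_def del: ln_mult)
  ultimately have "ln R = ln 0.054886 - real n / 2 * ln 2 - 3 / 2 * ln n + real n / 6 * (5 * ln 5 - 8 * ln 2) - 2.51012 * s"
    unfolding R_def using assms by (simp add: ln_mult_pos ln_div ln_powr)
  moreover have "ln (0.054886 :: real) \<le> 0" "ln n \<ge> 0" using assms by simp_all
  moreover have "real n / 6 * (5 * ln 5 - 8 * ln 2) - real n / 2 * ln 2 = n * (5 / 6 * ln 5 - 11 / 6 * ln 2)"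
    by (simp add: algebra_simps add_divide_distrib diff_divide_distrib)
  ultimately have "ln R \<le> n * (5 / 6 * ln 5 - 11 / 6 * ln 2) - 2.51012 * s"
    by linarith
  also have "\<dots> \<le> C"
  proof (cases "s \<ge> 128")
    case True
    thus ?thesis using s(2) psi by (rule interval_primes_lower_bound)
  next
    case False
    \<comment> \<open>The coefficient is about 0.0704. With \<open>n = s * s / 5\<close> and
      \<open>s < 128\<close> the term is at most 0.0142 * 128 = 1.8176 times \<open>s\<close>, less
      than \<open>2.51012 * s\<close>.\<close>
    have "n * (5 / 6 * ln 5 - 11 / 6 * ln 2) \<le> real n * 0.071"
      using ln_numeral_bounds by (intro mult_left_mono) auto
    also have "\<dots> = 0.0142 * (s * s)" using s(2) by (simp add: power2_eq_square)
    also have "s * s \<le> 128 * s" using False s by (intro mult_right_mono) auto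
    finally have "n * (5 / 6 * ln 5 - 11 / 6 * ln 2) - 2.51012 * s \<le> 0" using s(1) by simp
    also have "0 \<le> C" using L by (simp add: C_def)
    finally show ?thesis .
  qed
  finally have "log (5 * real n) R \<le> real (card {p::nat. prime p \<and> 4 * n < p \<and> p < 5 * n})"
    using L by (simp add: log_def C_def divide_le_eq)
  thus ?thesis by (simp add: R_def)
qed

end
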